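(* Let $X$ be a set. (1) The set $S(X)\times M(X)$, with the binary operations $\bar{\ast}$ and $\bar{\odot}$ defined in the context, and the embedding $i_X:X\to S(X)\times M(X)$, $x\mapsto x\otimes 1$, is the free totally compatible disemigroup on $X$. That is, $(S(X)\times M(X),\bar{\ast},\bar{\odot})$ is a totally compatible disemigroup and, for every totally compatible disemigroup $(S,\ast,\odot)$ and every set map $f:X\to S$, there exists a unique homomorphism of totally compatible disemigroups $\bar f:S(X)\times M(X)\to S$ such that $f=\bar f\circ i_X$. (2) The $\mathbf{k}$-module $F(X)=\mathbf{k}\langle X\rangle^0\otimes\mathbf{k}\langle X\rangle$, with the bilinear operations $\bar{\ast}$ and $\bar{\odot}$ defined in the context, and the embedding $i_X:X\to F(X)$, $x\mapsto x\otimes 1$, is the free totally compatible dialgebra on $X$. That is, $(F(X),\bar{\ast},\bar{\odot})$ is a totally compatible dialgebra and, for every totally compatible dialgebra $(R,\ast,\odot)$ over $\mathbf{k}$ and every set map $f:X\to R$, there exists a unique homomorphism of totally compatible dialgebras $\bar f:F(X)\to R$ such that $f=\bar f\circ i_X$.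
   Context: $\mathbf{k}$ is a commutative unitary ring; $\otimes=\otimes_{\mathbf{k}}$. A totally compatible dialgebra is a $\mathbf{k}$-module $R$ with two bilinear binary operations $\ast,\odot$ that are both associative and satisfy $(a\ast b)\odot c=a\ast(b\odot c)=(a\odot b)\ast c=a\odot(b\ast c)$ for all $a,b,c\in R$. A homomorphism of totally compatible dialgebras is a $\mathbf{k}$-linear map preserving both operations. A totally compatible disemigroup is a set $S$ with two binary operations $\ast,\odot$ satisfying the same identities (both associative, and the displayed mixed identities); a homomorphism is a map preserving both operations. $S(X)=\{x_1\cdots x_n\mid x_i\in X,\ 1\le i\le n,\ n\ge 1\}$ is the free semigroup on $X$ and $M(X)$ is the free monoid on $X$ (with identity $1$). $\mathbf{k}\langle X\rangle^0:=\mathbf{k}\,S(X)$ and $\mathbf{k}\langle X\rangle:=\mathbf{k}\,M(X)$ are the noncommutative nonunitary, respectively unitary, polynomial algebras. As a $\mathbf{k}$-module, $F(X):=\mathbf{k}\langle X\rangle^0\otimes\mathbf{k}\langle X\rangle\cong\mathbf{k}(S(X)\times M(X))$ has basis $S(X)\times M(X)$; the pair $(u,v)\in S(X)\times M(X)$ is written $u\otimes v$. The operations on $S(X)\times M(X)$ are defined as follows. Let $$\mathfrak{a}=(x_1\cdots x_m)\otimes(x_{m+1}\cdots x_{m+n}),\qquad \mathfrak{b}=(x_{m+n+1}\cdots x_{m+n+k})\otimes(x_{m+n+k+1}\cdots x_{m+n+k+\ell}),$$ with all $x_i\in X$, $m,k\ge 1$, $n,\ell\ge 0$, where an empty word is $1$.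 Then $$\mathfrak{a}\,\bar{\ast}\,\mathfrak{b}=(x_1\cdots x_{m+k})\otimes(x_{m+k+1}\cdots x_{m+n+k+\ell}),$$ $$\mathfrak{a}\,\bar{\odot}\,\mathfrak{b}=(x_1\cdots x_{m+k-1})\otimes(x_{m+k}\cdots x_{m+n+k+\ell}).$$ In particular, when $n=\ell=0$, $((x_1\cdots x_m)\otimes 1)\,\bar{\ast}\,((x_{m+1}\cdots x_{m+k})\otimes 1)=(x_1\cdots x_{m+k})\otimes 1$ and $((x_1\cdots x_m)\otimes 1)\,\bar{\odot}\,((x_{m+1}\cdots x_{m+k})\otimes 1)=(x_1\cdots x_{m+k-1})\otimes x_{m+k}$. These operations are extended to $F(X)$ by $\mathbf{k}$-bilinearity. *)

theory Defs
  imports "HOL-Algebra.Module"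
begin

section \<open>Totally compatible disemigroups and dialgebras\<close>

locale totally_compatible_disemigroup =
  fixes S :: "'a set" and ast circ :: "'a \<Rightarrow> 'a \<Rightarrow> 'a"
  assumes ast_closed: "\<lbrakk>a \<in> S; b \<in> S\<rbrakk> \<Longrightarrow> ast a b \<in> S"
    and circ_closed: "\<lbrakk>a \<in> S; b \<in> S\<rbrakk> \<Longrightarrow> circ a b \<in> S"
    and ast_assoc: "\<lbrakk>a \<in> S; b \<in> S; c \<in> S\<rbrakk> \<Longrightarrow> ast (ast a b) c = ast a (ast b c)"
    and circ_assoc: "\<lbrakk>a \<in> S; b \<in> S; c \<in> S\<rbrakk> \<Longrightarrow> circ (circ a b) c = circ a (circ b c)"
    and mixed1: "\<lbrakk>a \<in> S; b \<in> S; c \<in> S\<rbrakk> \<Longrightarrow> circ (ast a b) c = ast a (circ b c)"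
    and mixed2: "\<lbrakk>a \<in> S; b \<in> S; c \<in> S\<rbrakk> \<Longrightarrow> ast a (circ b c) = ast (circ a b) c"
    and mixed3: "\<lbrakk>a \<in> S; b \<in> S; c \<in> S\<rbrakk> \<Longrightarrow> ast (circ a b) c = circ a (ast b c)"

definition disemigroup_hom ::
  "'a set \<Rightarrow> ('a \<Rightarrow> 'a \<Rightarrow> 'a) \<Rightarrow> ('a \<Rightarrow> 'a \<Rightarrow> 'a) \<Rightarrow>
   'b set \<Rightarrow> ('b \<Rightarrow> 'b \<Rightarrow> 'b) \<Rightarrow> ('b \<Rightarrow> 'b \<Rightarrow> 'b) \<Rightarrow> ('a \<Rightarrow> 'b) set" where
  "disemigroup_hom S ast circ T ast' circ' =
     {h \<in> S \<rightarrow> T. \<forall>a\<in>S. \<forall>b\<in>S.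
        h (ast a b) = ast' (h a) (h b) \<and> h (circ a b) = circ' (h a) (h b)}"

definition linear_maps ::
  "('k, 'n) ring_scheme \<Rightarrow> ('k, 'a, 'm) module_scheme \<Rightarrow> ('k, 'b, 'l) module_scheme \<Rightarrow> ('a \<Rightarrow> 'b) set" where
  "linear_maps K M N =
     {h \<in> carrier M \<rightarrow> carrier N.
        (\<forall>x\<in>carrier M. \<forall>y\<in>carrier M. h (x \<oplus>\<^bsub>M\<^esub> y) = h x \<oplus>\<^bsub>N\<^esub> h y) \<and>
        (\<forall>r\<in>carrier K. \<forall>x\<in>carrier M. h (r \<odot>\<^bsub>M\<^esub> x) = r \<odot>\<^bsub>N\<^esub> h x)}"

definition bilinear_map ::
  "('k, 'n) ring_scheme \<Rightarrow> ('k, 'a, 'm) module_scheme \<Rightarrow> ('k, 'b, 'l) module_scheme \<Rightarrow>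
   ('k, 'c, 'p) module_scheme \<Rightarrow> ('a \<Rightarrow> 'b \<Rightarrow> 'c) \<Rightarrow> bool" where
  "bilinear_map K A B C t \<longleftrightarrow>
     (\<forall>a\<in>carrier A. (\<lambda>b. t a b) \<in> linear_maps K B C) \<and>
     (\<forall>b\<in>carrier B. (\<lambda>a. t a b) \<in> linear_maps K A C)"

text \<open>The library's module record extends the ring record, so a module carries a
  multiplication and a unit that the locale \<^locale>\<open>module\<close> ignores; they play no role below.\<close>

locale totally_compatible_dialgebra =
  module K R + totally_compatible_disemigroup "carrier R" ast circ
  for K (structure) and R (structure) and ast circ +
  assumes ast_bilinear: "bilinear_map K R R R ast"
    and circ_bilinear: "bilinear_map K R R R circ"

definition dialgebra_hom ::
  "('k, 'n) ring_scheme \<Rightarrow>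
   ('k, 'a, 'm) module_scheme \<Rightarrow> ('a \<Rightarrow> 'a \<Rightarrow> 'a) \<Rightarrow> ('a \<Rightarrow> 'a \<Rightarrow> 'a) \<Rightarrow>
   ('k, 'b, 'l) module_scheme \<Rightarrow> ('b \<Rightarrow> 'b \<Rightarrow> 'b) \<Rightarrow> ('b \<Rightarrow> 'b \<Rightarrow> 'b) \<Rightarrow> ('a \<Rightarrow> 'b) set" where
  "dialgebra_hom K R ast circ T ast' circ' =
     linear_maps K R T \<inter> disemigroup_hom (carrier R) ast circ (carrier T) ast' circ'"


section \<open>Words\<close>

text \<open>Words are lists of letters; the empty word \<open>[]\<close> is the identity of the free monoid.\<close>

definition free_semigroup :: "'x set \<Rightarrow> 'x list set" where
  "free_semigroup X = lists X - {[]}"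

definition free_monoid :: "'x set \<Rightarrow> 'x list set" where
  "free_monoid X = lists X"

text \<open>A pair \<open>(u, v)\<close> stands for \<open>u \<otimes> v\<close>. Both products write down the concatenation
  of all four words in order and only differ in where it is cut.\<close>

fun ast_bar :: "'x list \<times> 'x list \<Rightarrow> 'x list \<times> 'x list \<Rightarrow> 'x list \<times> 'x list" where
  "ast_bar (u, v) (u', v') =
     (let w = u @ v @ u' @ v'; c = length u + length u' in (take c w, drop c w))"

fun circ_bar :: "'x list \<times> 'x list \<Rightarrow> 'x list \<times> 'x list \<Rightarrow> 'x list \<times> 'x list" where
  "circ_bar (u, v) (u', v') =
     (let w = u @ v @ u' @ v'; c = length u + length u' - 1 in (take c w, drop c w))"

definition word_embed :: "'x \<Rightarrow> 'x list \<times> 'x list" where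
  "word_embed x = ([x], [])"


section \<open>Free modules and their tensor product\<close>

definition supp :: "('k, 'n) ring_scheme \<Rightarrow> ('b \<Rightarrow> 'k) \<Rightarrow> 'b set" where
  "supp K p = {b. p b \<noteq> \<zero>\<^bsub>K\<^esub>}"

text \<open>The free module \<open>K B\<close> on a set \<open>B\<close>: finitely supported families of coefficients,
  extended by zero outside \<open>B\<close>.\<close>

definition free_module :: "('k, 'n) ring_scheme \<Rightarrow> 'b set \<Rightarrow> ('k, 'b \<Rightarrow> 'k) module" where
  "free_module K B =
     \<lparr>carrier = {p. (\<forall>b. p b \<in> carrier K) \<and> supp K p \<subseteq> B \<and> finite (supp K p)},
      mult = undefined, one = undefined,
      zero = (\<lambda>b. \<zero>\<^bsub>K\<^esub>), add = (\<lambda>p q b. p b \<oplus>\<^bsub>K\<^esub> q b),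
      smult = (\<lambda>r p b. r \<otimes>\<^bsub>K\<^esub> p b)\<rparr>"

definition single :: "('k, 'n) ring_scheme \<Rightarrow> 'b \<Rightarrow> 'b \<Rightarrow> 'k" where
  "single K b = (\<lambda>c. if c = b then \<one>\<^bsub>K\<^esub> else \<zero>\<^bsub>K\<^esub>)"

definition tensor :: "('k, 'n) ring_scheme \<Rightarrow> ('b \<Rightarrow> 'k) \<Rightarrow> ('c \<Rightarrow> 'k) \<Rightarrow> 'b \<times> 'c \<Rightarrow> 'k" where
  "tensor K p q = (\<lambda>(b, c). p b \<otimes>\<^bsub>K\<^esub> q c)"

definition linear_ext ::
  "('k, 'n) ring_scheme \<Rightarrow> ('k, 'a, 'm) module_scheme \<Rightarrow> ('b \<Rightarrow> 'a) \<Rightarrow> ('b \<Rightarrow> 'k) \<Rightarrow> 'a" where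
  "linear_ext K N f p = finsum N (\<lambda>b. p b \<odot>\<^bsub>N\<^esub> f b) (supp K p)"

text \<open>The extension by bilinearity of an operation \<open>op\<close> on a basis \<open>B\<close>.\<close>

definition bilinear_ext ::
  "('k, 'n) ring_scheme \<Rightarrow> 'b set \<Rightarrow> ('b \<Rightarrow> 'b \<Rightarrow> 'b) \<Rightarrow> ('b \<Rightarrow> 'k) \<Rightarrow> ('b \<Rightarrow> 'k) \<Rightarrow> 'b \<Rightarrow> 'k" where
  "bilinear_ext K B op p q =
     finsum (free_module K B)
       (\<lambda>(a, b). (p a \<otimes>\<^bsub>K\<^esub> q b) \<odot>\<^bsub>free_module K B\<^esub> single K (op a b)) (supp K p \<times> supp K q)"

text \<open>The modules underlying the nonunitary and the unitary noncommutative polynomial algebra.\<close>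

definition poly0 :: "('k, 'n) ring_scheme \<Rightarrow> 'x set \<Rightarrow> ('k, 'x list \<Rightarrow> 'k) module" where
  "poly0 K X = free_module K (free_semigroup X)"

definition poly1 :: "('k, 'n) ring_scheme \<Rightarrow> 'x set \<Rightarrow> ('k, 'x list \<Rightarrow> 'k) module" where
  "poly1 K X = free_module K (free_monoid X)"

text \<open>\<open>F(X)\<close> is the tensor product of \<^term>\<open>poly0 K X\<close> and \<^term>\<open>poly1 K X\<close>, realised as the
  free module on pairs of words; \<open>F_is_tensor_product\<close> below shows that, together with
  \<^term>\<open>tensor K\<close>, it has the universal property of the tensor product.\<close>

definition F_module :: "('k, 'n) ring_scheme \<Rightarrow> 'x set \<Rightarrow> ('k, 'x list \<times> 'x list \<Rightarrow> 'k) module" where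
  "F_module K X = free_module K (free_semigroup X \<times> free_monoid X)"

definition F_ast ::
  "('k, 'n) ring_scheme \<Rightarrow> 'x set \<Rightarrow>
   ('x list \<times> 'x list \<Rightarrow> 'k) \<Rightarrow> ('x list \<times> 'x list \<Rightarrow> 'k) \<Rightarrow> ('x list \<times> 'x list \<Rightarrow> 'k)" where
  "F_ast K X = bilinear_ext K (free_semigroup X \<times> free_monoid X) ast_bar"

definition F_circ ::
  "('k, 'n) ring_scheme \<Rightarrow> 'x set \<Rightarrow>
   ('x list \<times> 'x list \<Rightarrow> 'k) \<Rightarrow> ('x list \<times> 'x list \<Rightarrow> 'k) \<Rightarrow> ('x list \<times> 'x list \<Rightarrow> 'k)" where
  "F_circ K X = bilinear_ext K (free_semigroup X \<times> free_monoid X) circ_bar"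

definition F_embed :: "('k, 'n) ring_scheme \<Rightarrow> 'x \<Rightarrow> 'x list \<times> 'x list \<Rightarrow> 'k" where
  "F_embed K x = tensor K (single K [x]) (single K [])"


section \<open>The constructions have the expected properties\<close>

lemma free_module_sel [simp]:
  "carrier (free_module K B) = {p. (\<forall>b. p b \<in> carrier K) \<and> supp K p \<subseteq> B \<and> finite (supp K p)}"
  "zero (free_module K B) = (\<lambda>b. \<zero>\<^bsub>K\<^esub>)"
  "add (free_module K B) = (\<lambda>p q b. p b \<oplus>\<^bsub>K\<^esub> q b)"
  "smult (free_module K B) = (\<lambda>r p b. r \<otimes>\<^bsub>K\<^esub> p b)"
  by (simp_all add: free_module_def)

context cring
begin

lemma supp_add: "supp R (\<lambda>b. p b \<oplus> q b) \<subseteq> supp R p \<union> supp R q"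
  by (auto simp: supp_def)

lemma supp_smult: "r \<in> carrier R \<Longrightarrow> supp R (\<lambda>b. r \<otimes> p b) \<subseteq> supp R p"
  by (auto simp: supp_def)

lemma supp_single: "supp R (single R b) \<subseteq> {b}"
  by (auto simp: supp_def single_def)

lemma single_closed: "b \<in> B \<Longrightarrow> single R b \<in> carrier (free_module R B)"
  using supp_single[of b] by (auto simp: single_def intro: finite_subset)

lemma free_module_is_module: "module R (free_module R B)"
proof (rule moduleI)
  show "abelian_group (free_module R B)"
  proof (rule abelian_groupI)
    fix p q assume "p \<in> carrier (free_module R B)" "q \<in> carrier (free_module R B)"
    then show "p \<oplus>\<^bsub>free_module R B\<^esub> q \<in> carrier (free_module R B)"
      using supp_add[of p q] by (auto intro: finite_subset)
  next
    fix p assume p: "p \<in> carrier (free_module R B)"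
    then have "supp R (\<lambda>b. \<ominus> p b) \<subseteq> supp R p"
      by (auto simp: supp_def)
    with p show "\<exists>y\<in>carrier (free_module R B). y \<oplus>\<^bsub>free_module R B\<^esub> p = \<zero>\<^bsub>free_module R B\<^esub>"
      by (intro bexI[of _ "\<lambda>b. \<ominus> p b"]) (auto simp: l_neg intro: finite_subset)
  qed (auto simp: supp_def a_ac)
next
  fix r p assume "r \<in> carrier R" "p \<in> carrier (free_module R B)"
  then show "r \<odot>\<^bsub>free_module R B\<^esub> p \<in> carrier (free_module R B)"
    using supp_smult[of r p] by (auto intro: finite_subset)
qed (auto simp: l_distr r_distr m_assoc cring_axioms)

lemma linear_map_zero:
  assumes "module R M" "module R N" "h \<in> linear_maps R M N"
  shows "h \<zero>\<^bsub>M\<^esub> = \<zero>\<^bsub>N\<^esub>"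
proof -
  interpret M: module R M by fact
  interpret N: module R N by fact
  have "h (\<zero> \<odot>\<^bsub>M\<^esub> \<zero>\<^bsub>M\<^esub>) = \<zero> \<odot>\<^bsub>N\<^esub> h \<zero>\<^bsub>M\<^esub>" "h \<zero>\<^bsub>M\<^esub> \<in> carrier N"
    using assms(3) by (auto simp: linear_maps_def simp del: M.smult_l_null M.smult_r_null)
  then show ?thesis by simp
qed

text \<open>Linear maps out of a free module are determined by their values on the basis.\<close>

lemma linear_maps_eq_on_basis:
  assumes N: "module R N"
    and g: "g \<in> linear_maps R (free_module R B) N"
    and h: "h \<in> linear_maps R (free_module R B) N"
    and gh: "\<And>b. b \<in> B \<Longrightarrow> g (single R b) = h (single R b)"
    and p: "p \<in> carrier (free_module R B)"
  shows "g p = h p"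
proof -
  have "g p = h p" if "finite A" "supp R p \<subseteq> A" "p \<in> carrier (free_module R B)" for A p
    using that
  proof (induction A arbitrary: p rule: finite_induct)
    case empty
    then have "p = \<zero>\<^bsub>free_module R B\<^esub>"
      by (auto simp: supp_def)
    then show ?case
      using linear_map_zero[OF free_module_is_module N] g h by metis
  next
    case (insert a A)
    show ?case
    proof (cases "a \<in> supp R p")
      case False
      with insert show ?thesis by blast
    next
      case True
      let ?q = "p(a := \<zero>)" and ?s = "p a \<odot>\<^bsub>free_module R B\<^esub> single R a"
      interpret FM: module R "free_module R B" by (rule free_module_is_module)
      have aB: "a \<in> B" and pa: "p a \<in> carrier R"
        using True insert.prems by auto
      have sq: "supp R ?q \<subseteq> A" "supp R ?q \<subseteq> supp R p"
        using insert.prems by (auto simp: supp_def)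
      have q: "?q \<in> carrier (free_module R B)"
        using insert.prems sq by (auto intro: finite_subset)
      have sa: "single R a \<in> carrier (free_module R B)"
        using single_closed aB .
      have s: "?s \<in> carrier (free_module R B)"
        using FM.smult_closed[OF pa sa] .
      have eq: "p = ?q \<oplus>\<^bsub>free_module R B\<^esub> ?s"
        using insert.prems by (auto simp: single_def)
      have split: "k p = k ?q \<oplus>\<^bsub>N\<^esub> p a \<odot>\<^bsub>N\<^esub> k (single R a)"
        if k: "k \<in> linear_maps R (free_module R B) N" for k
      proof -
        have "k p = k (?q \<oplus>\<^bsub>free_module R B\<^esub> ?s)"
          by (rule arg_cong[OF eq])
        also have "\<dots> = k ?q \<oplus>\<^bsub>N\<^esub> k ?s"
          using k q s unfolding linear_maps_def by blast
        also have "k ?s = p a \<odot>\<^bsub>N\<^esub> k (single R a)"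
          using k sa pa unfolding linear_maps_def by blast
        finally show ?thesis .
      qed
      have "g p = h ?q \<oplus>\<^bsub>N\<^esub> p a \<odot>\<^bsub>N\<^esub> h (single R a)"
        using insert.IH[OF sq(1) q] gh[OF aB] split[OF g] by argo
      also have "\<dots> = h p"
        by (rule split[OF h, symmetric])
      finally show ?thesis .
    qed
  qed
  from this[of "supp R p" p] p show ?thesis by simp
qed

lemma linear_ext_superset:
  assumes N: "module R N" and f: "f \<in> B \<rightarrow> carrier N"
    and p: "\<And>b. p b \<in> carrier R" and A: "finite A" "supp R p \<subseteq> A" "A \<subseteq> B"
  shows "linear_ext R N f p = finsum N (\<lambda>b. p b \<odot>\<^bsub>N\<^esub> f b) A"
proof -
  interpret N: module R N by fact
  show ?thesis
    unfolding linear_ext_def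
    by (rule N.add.finprod_mono_neutral_cong_left) (use f p A in \<open>auto simp: supp_def Pi_iff subset_iff\<close>)
qed

lemma linear_ext_linear:
  assumes N: "module R N" and f: "f \<in> B \<rightarrow> carrier N"
  shows "linear_ext R N f \<in> linear_maps R (free_module R B) N"
proof -
  interpret N: module R N by fact
  have closed: "linear_ext R N f p \<in> carrier N" if "p \<in> carrier (free_module R B)" for p
    unfolding linear_ext_def by (rule N.add.finprod_closed) (use f that in auto)
  have add: "linear_ext R N f (\<lambda>b. p b \<oplus> q b) = linear_ext R N f p \<oplus>\<^bsub>N\<^esub> linear_ext R N f q"
    if "p \<in> carrier (free_module R B)" "q \<in> carrier (free_module R B)" for p q
  proof -
    let ?A = "supp R p \<union> supp R q"
    have A: "finite ?A" "?A \<subseteq> B" using that by auto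
    have "linear_ext R N f (\<lambda>b. p b \<oplus> q b) = (\<Oplus>\<^bsub>N\<^esub>b\<in>?A. (p b \<oplus> q b) \<odot>\<^bsub>N\<^esub> f b)"
      by (rule linear_ext_superset[OF N f]) (use that A supp_add[of p q] in auto)
    also have "\<dots> = (\<Oplus>\<^bsub>N\<^esub>b\<in>?A. p b \<odot>\<^bsub>N\<^esub> f b \<oplus>\<^bsub>N\<^esub> q b \<odot>\<^bsub>N\<^esub> f b)"
      by (rule N.add.finprod_cong') (use that A f in \<open>auto simp: N.smult_l_distr Pi_iff\<close>)
    also have "\<dots> = (\<Oplus>\<^bsub>N\<^esub>b\<in>?A. p b \<odot>\<^bsub>N\<^esub> f b) \<oplus>\<^bsub>N\<^esub> (\<Oplus>\<^bsub>N\<^esub>b\<in>?A. q b \<odot>\<^bsub>N\<^esub> f b)"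
      by (rule N.add.finprod_multf) (use that f in \<open>auto simp: Pi_iff subset_iff\<close>)
    also have "\<dots> = linear_ext R N f p \<oplus>\<^bsub>N\<^esub> linear_ext R N f q"
      using linear_ext_superset[OF N f, of p ?A] linear_ext_superset[OF N f, of q ?A] that A
      by simp
    finally show ?thesis .
  qed
  have smult: "linear_ext R N f (\<lambda>b. r \<otimes> p b) = r \<odot>\<^bsub>N\<^esub> linear_ext R N f p"
    if "r \<in> carrier R" "p \<in> carrier (free_module R B)" for r p
  proof -
    have "linear_ext R N f (\<lambda>b. r \<otimes> p b) = (\<Oplus>\<^bsub>N\<^esub>b\<in>supp R p. (r \<otimes> p b) \<odot>\<^bsub>N\<^esub> f b)"
      by (rule linear_ext_superset[OF N f]) (use that supp_smult[of r p] in auto)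
    also have "\<dots> = (\<Oplus>\<^bsub>N\<^esub>b\<in>supp R p. r \<odot>\<^bsub>N\<^esub> (p b \<odot>\<^bsub>N\<^esub> f b))"
      by (rule N.add.finprod_cong') (use that f in \<open>auto simp: N.smult_assoc1 Pi_iff subset_iff\<close>)
    also have "\<dots> = r \<odot>\<^bsub>N\<^esub> linear_ext R N f p"
      unfolding linear_ext_def
      by (rule N.finsum_smult_ldistr[symmetric]) (use that f in auto)
    finally show ?thesis .
  qed
  show ?thesis
    unfolding linear_maps_def using closed add smult by simp
qed

lemma linear_ext_single:
  assumes N: "module R N" and f: "f \<in> B \<rightarrow> carrier N" and b: "b \<in> B"
  shows "linear_ext R N f (single R b) = f b"
proof -
  interpret N: module R N by fact
  have fb: "f b \<in> carrier N" using f b by auto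
  have "linear_ext R N f (single R b) = (\<Oplus>\<^bsub>N\<^esub>c\<in>{b}. single R b c \<odot>\<^bsub>N\<^esub> f c)"
    by (rule linear_ext_superset[OF N f]) (use b in \<open>auto simp: single_def supp_def\<close>)
  also have "\<dots> = single R b b \<odot>\<^bsub>N\<^esub> f b"
    by (subst N.finsum_insert) (use fb in \<open>auto simp: single_def\<close>)
  also have "\<dots> = f b" using fb by (simp add: single_def)
  finally show ?thesis .
qed

lemma tensor_single: "tensor R (single R b) (single R c) = single R (b, c)"
  by (auto simp: tensor_def single_def fun_eq_iff)

lemma supp_tensor:
  assumes "\<And>b. p b \<in> carrier R" "\<And>c. q c \<in> carrier R"
  shows "supp R (tensor R p q) \<subseteq> supp R p \<times> supp R q"
  using assms by (auto simp: supp_def tensor_def)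

lemma tensor_closed:
  assumes "p \<in> carrier (free_module R B)" "q \<in> carrier (free_module R C)"
  shows "tensor R p q \<in> carrier (free_module R (B \<times> C))"
proof -
  have "supp R (tensor R p q) \<subseteq> supp R p \<times> supp R q"
    using assms by (intro supp_tensor) auto
  moreover have "finite (supp R p \<times> supp R q)" "supp R p \<times> supp R q \<subseteq> B \<times> C"
    using assms by auto
  ultimately have "supp R (tensor R p q) \<subseteq> B \<times> C" "finite (supp R (tensor R p q))"
    by (auto dest: finite_subset)
  with assms show ?thesis
    by (simp add: tensor_def split: prod.split)
qed

lemma tensor_bilinear:
  "bilinear_map R (free_module R B) (free_module R C) (free_module R (B \<times> C)) (tensor R)"
proof -
  have add: "tensor R p (\<lambda>c. q c \<oplus> q' c) = (\<lambda>x. tensor R p q x \<oplus> tensor R p q' x)"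
    "tensor R (\<lambda>c. q c \<oplus> q' c) p = (\<lambda>x. tensor R q p x \<oplus> tensor R q' p x)"
    if "\<forall>b. p b \<in> carrier R" "\<forall>b. q b \<in> carrier R" "\<forall>b. q' b \<in> carrier R"
    for p :: "'x \<Rightarrow> 'a" and q q' :: "'y \<Rightarrow> 'a"
    using that by (simp_all add: tensor_def fun_eq_iff l_distr r_distr)
  have smult: "tensor R p (\<lambda>c. r \<otimes> q c) = (\<lambda>x. r \<otimes> tensor R p q x)"
    "tensor R (\<lambda>c. r \<otimes> q c) p = (\<lambda>x. r \<otimes> tensor R q p x)"
    if "\<forall>b. p b \<in> carrier R" "\<forall>b. q b \<in> carrier R" "r \<in> carrier R"
    for p :: "'x \<Rightarrow> 'a" and q :: "'y \<Rightarrow> 'a" and r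
    using that by (simp_all add: tensor_def fun_eq_iff m_lcomm m_assoc)
  have "tensor R p \<in> linear_maps R (free_module R C) (free_module R (B \<times> C))"
    if "p \<in> carrier (free_module R B)" for p
    using that tensor_closed[OF that] add(1)[of p] smult(1)[of p] unfolding linear_maps_def by auto
  moreover have "(\<lambda>p. tensor R p q) \<in> linear_maps R (free_module R B) (free_module R (B \<times> C))"
    if "q \<in> carrier (free_module R C)" for q
    using that tensor_closed[OF _ that] add(2)[of q] smult(2)[of q] unfolding linear_maps_def by auto
  ultimately show ?thesis
    unfolding bilinear_map_def by blast
qed

lemma bilinear_maps_eq_on_basis:
  assumes N: "module R N"
    and s: "bilinear_map R (free_module R B) (free_module R C) N s"
    and t: "bilinear_map R (free_module R B) (free_module R C) N t"
    and st: "\<And>b c. \<lbrakk>b \<in> B; c \<in> C\<rbrakk> \<Longrightarrow> s (single R b) (single R c) = t (single R b) (single R c)"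
    and p: "p \<in> carrier (free_module R B)" and q: "q \<in> carrier (free_module R C)"
  shows "s p q = t p q"
proof -
  have "s (single R b) q = t (single R b) q" if b: "b \<in> B" for b
  proof (rule linear_maps_eq_on_basis[OF N _ _ _ q])
    show "s (single R b) \<in> linear_maps R (free_module R C) N"
         "t (single R b) \<in> linear_maps R (free_module R C) N"
      using s t single_closed[OF b] unfolding bilinear_map_def by blast+
  qed (rule st[OF b])
  then show ?thesis
    by (intro linear_maps_eq_on_basis[OF N _ _ _ p, of "\<lambda>p. s p q" "\<lambda>p. t p q"])
       (use s t q in \<open>unfold bilinear_map_def, blast+\<close>)
qed

lemma linear_comp_bilinear:
  assumes "h \<in> linear_maps R M N" "bilinear_map R A B M t"
  shows "bilinear_map R A B N (\<lambda>a b. h (t a b))"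
  using assms unfolding bilinear_map_def linear_maps_def by (simp add: Pi_iff)

lemma bilinear_map_closed:
  assumes "bilinear_map R A B N t" "a \<in> carrier A" "b \<in> carrier B"
  shows "t a b \<in> carrier N"
  using assms unfolding bilinear_map_def linear_maps_def by (simp add: Pi_iff)

lemma free_module_tensor_product:
  assumes N: "module R N"
    and t: "bilinear_map R (free_module R B) (free_module R C) N t"
  shows "\<exists>!h. h \<in> extensional (carrier (free_module R (B \<times> C))) \<and>
           h \<in> linear_maps R (free_module R (B \<times> C)) N \<and>
           (\<forall>p\<in>carrier (free_module R B). \<forall>q\<in>carrier (free_module R C). h (tensor R p q) = t p q)"
proof -
  let ?F = "free_module R (B \<times> C)"
  interpret FM: module R ?F by (rule free_module_is_module)
  define f where "f = (\<lambda>(b, c). t (single R b) (single R c))"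
  have f: "f \<in> B \<times> C \<rightarrow> carrier N"
    by (rule funcsetI) (auto simp: f_def simp del: free_module_sel intro!: bilinear_map_closed[OF t] single_closed)
  define g where "g = linear_ext R N f"
  define h where "h = restrict g (carrier ?F)"
  have g: "g \<in> linear_maps R ?F N"
    unfolding g_def by (rule linear_ext_linear[OF N f])
  have h: "h \<in> linear_maps R ?F N"
    using g FM.a_closed FM.smult_closed
    unfolding h_def linear_maps_def by (simp add: Pi_iff del: free_module_sel)
  have gt: "g (tensor R p q) = t p q"
    if "p \<in> carrier (free_module R B)" "q \<in> carrier (free_module R C)" for p q
    using linear_comp_bilinear[OF g tensor_bilinear] t _ that
  proof (rule bilinear_maps_eq_on_basis[OF N])
    fix b c assume "b \<in> B" "c \<in> C"
    then show "g (tensor R (single R b) (single R c)) = t (single R b) (single R c)"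
      using linear_ext_single[OF N f, of "(b, c)"] by (simp add: tensor_single g_def f_def)
  qed
  show ?thesis
  proof (rule ex1I[of _ h], intro conjI ballI)
    show "h \<in> extensional (carrier ?F)" by (simp add: h_def)
    show "h \<in> linear_maps R ?F N" by (rule h)
    show "h (tensor R p q) = t p q"
      if "p \<in> carrier (free_module R B)" "q \<in> carrier (free_module R C)" for p q
      using gt[OF that] tensor_closed[OF that] by (simp add: h_def del: free_module_sel)
  next
    fix h' assume h': "h' \<in> extensional (carrier ?F) \<and> h' \<in> linear_maps R ?F N \<and>
      (\<forall>p\<in>carrier (free_module R B). \<forall>q\<in>carrier (free_module R C). h' (tensor R p q) = t p q)"
    show "h' = h"
    proof (rule extensionalityI[of _ "carrier ?F"])
      fix x assume x: "x \<in> carrier ?F"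
      show "h' x = h x"
      proof (rule linear_maps_eq_on_basis[OF N _ h _ x])
        fix bc assume "bc \<in> B \<times> C"
        then obtain b c where bc: "bc = (b, c)" "b \<in> B" "c \<in> C" by auto
        have "h' (single R bc) = t (single R b) (single R c)"
          using h' single_closed bc by (metis tensor_single)
        also have "\<dots> = h (single R bc)"
          using gt[OF single_closed single_closed, OF bc(2,3)] bc single_closed[of "(b, c)" "B \<times> C"]
          by (simp add: h_def tensor_single del: free_module_sel)
        finally show "h' (single R bc) = h (single R bc)" .
      qed (use h' in auto)
    qed (use h' in \<open>auto simp: h_def\<close>)
  qed
qed

lemma F_is_tensor_product:
  shows "module R (F_module R X)"
    and "bilinear_map R (poly0 R X) (poly1 R X) (F_module R X) (tensor R)"
    and "\<lbrakk>module R N; bilinear_map R (poly0 R X) (poly1 R X) N t\<rbrakk> \<Longrightarrow>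
      \<exists>!h. h \<in> extensional (carrier (F_module R X)) \<and> h \<in> linear_maps R (F_module R X) N \<and>
        (\<forall>p\<in>carrier (poly0 R X). \<forall>q\<in>carrier (poly1 R X). h (tensor R p q) = t p q)"
  unfolding F_module_def poly0_def poly1_def
  by (rule free_module_is_module tensor_bilinear free_module_tensor_product; assumption)+

text \<open>\<^const>\<open>bilinear_ext\<close> is bilinear and agrees with \<open>op\<close> on the basis.\<close>

lemma bilinear_ext_tensor:
  assumes op: "\<And>a b. \<lbrakk>a \<in> B; b \<in> B\<rbrakk> \<Longrightarrow> op a b \<in> B"
    and p: "p \<in> carrier (free_module R B)" and q: "q \<in> carrier (free_module R B)"
  shows "bilinear_ext R B op p q =
    linear_ext R (free_module R B) (\<lambda>(a, b). single R (op a b)) (tensor R p q)"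
proof -
  interpret FM: module R "free_module R B" by (rule free_module_is_module)
  have f: "(\<lambda>(a, b). single R (op a b)) \<in> B \<times> B \<rightarrow> carrier (free_module R B)"
    by (rule funcsetI) (auto simp del: free_module_sel intro!: single_closed op)
  have "linear_ext R (free_module R B) (\<lambda>(a, b). single R (op a b)) (tensor R p q) =
    finsum (free_module R B) (\<lambda>x. tensor R p q x \<odot>\<^bsub>free_module R B\<^esub> (\<lambda>(a, b). single R (op a b)) x)
      (supp R p \<times> supp R q)"
    by (rule linear_ext_superset[OF free_module_is_module f])
       (use p q supp_tensor[of p q] in \<open>auto simp: tensor_def\<close>)
  also have "\<dots> = bilinear_ext R B op p q"
    unfolding bilinear_ext_def tensor_def by (simp add: case_prod_unfold)
  finally show ?thesis ..
qed

lemma bilinear_ext_bilinear: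
  assumes op: "\<And>a b. \<lbrakk>a \<in> B; b \<in> B\<rbrakk> \<Longrightarrow> op a b \<in> B"
  shows "bilinear_map R (free_module R B) (free_module R B) (free_module R B) (bilinear_ext R B op)"
proof -
  interpret FM: module R "free_module R B" by (rule free_module_is_module)
  have f: "(\<lambda>(a, b). single R (op a b)) \<in> B \<times> B \<rightarrow> carrier (free_module R B)"
    by (rule funcsetI) (auto simp del: free_module_sel intro!: single_closed op)
  have "bilinear_map R (free_module R B) (free_module R B) (free_module R B)
    (\<lambda>p q. linear_ext R (free_module R B) (\<lambda>(a, b). single R (op a b)) (tensor R p q))"
    by (rule linear_comp_bilinear[OF linear_ext_linear[OF free_module_is_module f] tensor_bilinear])
  then show ?thesis
    using bilinear_ext_tensor[of B op, OF op] FM.a_closed FM.smult_closed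
    unfolding bilinear_map_def linear_maps_def by (simp add: Pi_iff del: free_module_sel)
qed

lemma bilinear_ext_single:
  assumes op: "\<And>a b. \<lbrakk>a \<in> B; b \<in> B\<rbrakk> \<Longrightarrow> op a b \<in> B" and ab: "a \<in> B" "b \<in> B"
  shows "bilinear_ext R B op (single R a) (single R b) = single R (op a b)"
proof -
  have f: "(\<lambda>(a, b). single R (op a b)) \<in> B \<times> B \<rightarrow> carrier (free_module R B)"
    by (rule funcsetI) (auto simp del: free_module_sel intro!: single_closed op)
  show ?thesis
    using linear_ext_single[OF free_module_is_module f, of "(a, b)"] ab
    by (simp add: bilinear_ext_tensor[OF op] single_closed tensor_single del: free_module_sel)
qed

end

end

theory Submission
  imports Defs
begin

text \<open>In a totally compatible disemigroup, the value of a product of \<open>n\<close> factors in given order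
  depends only on how many of the \<open>n - 1\<close> operation signs are \<open>\<odot>\<close>: all bracketings agree,
  and the identity \<open>(a \<odot> b) * c = (a * b) \<odot> c\<close> lets every \<open>*\<close> move to the left of every
  \<open>\<odot>\<close>. Hence each product has the normal form
  \<open>a\<^sub>1 * \<dots> * a\<^sub>m \<odot> a\<^bsub>m+1\<^esub> \<odot> \<dots> \<odot> a\<^sub>n\<close>, bracketed to the left. A pair of words
  \<open>u \<otimes> v\<close> records exactly such a normal form in letters: the word \<open>uv\<close> together with the
  position \<open>m\<close> of the cut. Multiplying two normal forms concatenates the words and adds the numbers
  of \<open>*\<close>-signs, plus one if the joining sign is \<open>*\<close>; this is what \<^const>\<open>ast_bar\<close> and
  \<^const>\<open>circ_bar\<close> do.

  So evaluating normal forms is a homomorphism extending a given map on letters (the two lemmas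
  \<open>ast_normal_product\<close> and \<open>circ_normal_product\<close>), and it is the only one because the letters
  generate all pairs (\<open>disemigroup_hom_eq_on_letters\<close>).

  The dialgebra statement follows formally: the free module on any totally compatible disemigroup
  is a totally compatible dialgebra, and linear extension turns disemigroup homomorphisms into a
  dialgebra \<open>R\<close> into dialgebra homomorphisms (\<open>free_module_dialgebra\<close>,
  \<open>linear_ext_dialgebra_hom\<close>). Every identity involved is multilinear, so it suffices to check it
  on basis elements.\<close>

section \<open>The disemigroup of pairs of words\<close>

text \<open>A pair of words is determined by the concatenated word and the position of the cut, and in
  these coordinates both operations are concatenation and addition, shifted by one for
  \<^const>\<open>circ_bar\<close>. Since first words are nonempty, the truncated subtraction never truncates, and
  the axioms of a totally compatible disemigroup become evident.\<close>

lemma word_pair_eqI: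
  assumes "fst p @ snd p = fst q @ snd q" "length (fst p) = length (fst q)"
  shows "p = q"
  using assms by (simp add: prod_eq_iff)

lemma word_ast_bar: "fst (ast_bar p q) @ snd (ast_bar p q) = (fst p @ snd p) @ (fst q @ snd q)"
  by (cases p; cases q) (simp add: Let_def del: take_append drop_append)

lemma word_circ_bar: "fst (circ_bar p q) @ snd (circ_bar p q) = (fst p @ snd p) @ (fst q @ snd q)"
  by (cases p; cases q) (simp add: Let_def del: take_append drop_append)

lemma cut_ast_bar: "length (fst (ast_bar p q)) = length (fst p) + length (fst q)"
  by (cases p; cases q) (simp add: Let_def del: take_append drop_append)

lemma cut_circ_bar: "length (fst (circ_bar p q)) = length (fst p) + length (fst q) - 1"
  by (cases p; cases q) (simp add: Let_def del: take_append drop_append)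

lemma word_pairs_iff:
  "p \<in> free_semigroup X \<times> free_monoid X \<longleftrightarrow> fst p @ snd p \<in> lists X \<and> 0 < length (fst p)"
  by (cases p) (auto simp: free_semigroup_def free_monoid_def)

lemma word_pairs_disemigroup:
  fixes X :: "'x set"
  shows "totally_compatible_disemigroup (free_semigroup X \<times> free_monoid X) ast_bar circ_bar"
proof
  fix a b :: "'x list \<times> 'x list"
  assume "a \<in> free_semigroup X \<times> free_monoid X" "b \<in> free_semigroup X \<times> free_monoid X"
  then have "fst a @ snd a \<in> lists X" "fst b @ snd b \<in> lists X"
    "0 < length (fst a)" "0 < length (fst b)"
    unfolding word_pairs_iff by blast+
  then show "ast_bar a b \<in> free_semigroup X \<times> free_monoid X"
    "circ_bar a b \<in> free_semigroup X \<times> free_monoid X"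
    unfolding word_pairs_iff word_ast_bar word_circ_bar cut_ast_bar cut_circ_bar
    by (auto simp del: length_greater_0_conv)
qed (rule word_pair_eqI; (simp only: word_pairs_iff word_ast_bar word_circ_bar append_assoc
       cut_ast_bar cut_circ_bar, linarith?))+

lemma word_embed_in_word_pairs: "x \<in> X \<Longrightarrow> word_embed x \<in> free_semigroup X \<times> free_monoid X"
  by (simp add: word_embed_def free_semigroup_def free_monoid_def)

text \<open>The letters generate: a letter is appended to the first word by \<open>*\<close>-multiplication from the
  right as long as the second word is empty, and to the second word by \<open>\<odot>\<close>-multiplication.\<close>

lemma disemigroup_hom_eq_on_letters:
  assumes g: "g \<in> disemigroup_hom (free_semigroup X \<times> free_monoid X) ast_bar circ_bar S ast circ"
    and h: "h \<in> disemigroup_hom (free_semigroup X \<times> free_monoid X) ast_bar circ_bar S ast circ"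
    and letters: "\<And>x. x \<in> X \<Longrightarrow> g (word_embed x) = h (word_embed x)"
    and p: "p \<in> free_semigroup X \<times> free_monoid X"
  shows "g p = h p"
proof -
  let ?P = "free_semigroup X \<times> free_monoid X"
  have ast: "g (ast_bar a b) = h (ast_bar a b)" and circ: "g (circ_bar a b) = h (circ_bar a b)"
    if "a \<in> ?P" "b \<in> ?P" "g a = h a" "g b = h b" for a b
    using g h that unfolding disemigroup_hom_def mem_Collect_eq by metis+
  have first: "g (u, []) = h (u, [])" if "u \<noteq> []" "u \<in> lists X" for u
    using that
  proof (induction u rule: rev_nonempty_induct)
    case (single x)
    then show ?case using letters[of x] by (simp add: word_embed_def)
  next
    case (snoc x u)
    have "ast_bar (u, []) (word_embed x) = (u @ [x], [])"
      by (simp add: word_embed_def Let_def)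
    then show ?case
      using ast[of "(u, [])" "word_embed x"] snoc letters[of x] word_embed_in_word_pairs[of x X]
      by (simp add: free_semigroup_def free_monoid_def)
  qed
  have "g (u, v) = h (u, v)" if "u \<noteq> []" "u \<in> lists X" "v \<in> lists X" for u v
    using that(3)
  proof (induction v rule: rev_induct)
    case Nil
    then show ?case using first that by simp
  next
    case (snoc x v)
    have "circ_bar (u, v) (word_embed x) = (u, v @ [x])"
      by (simp add: word_embed_def Let_def)
    then show ?case
      using circ[of "(u, v)" "word_embed x"] that snoc letters[of x] word_embed_in_word_pairs[of x X]
      by (simp add: free_semigroup_def free_monoid_def)
  qed
  with p show ?thesis
    by (auto simp: free_semigroup_def free_monoid_def)
qed

section \<open>Normal forms of products\<close>

context totally_compatible_disemigroup
begin

text \<open>The left-bracketed product of the list \<open>as\<close> with \<open>n - 1\<close> signs \<open>*\<close> followed by signs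
  \<open>\<odot>\<close>; only \<open>1 \<le> n \<le> length as\<close> is meaningful.\<close>

definition normal_product :: "nat \<Rightarrow> 'a list \<Rightarrow> 'a" where
  "normal_product n as = foldl circ (foldl ast (hd as) (tl (take n as))) (drop n as)"

lemma normal_product_single [simp]: "normal_product (Suc 0) [a] = a"
  by (simp add: normal_product_def)

lemma normal_product_snoc_circ:
  "n \<le> length as \<Longrightarrow> 0 < n \<Longrightarrow> normal_product n (as @ [a]) = circ (normal_product n as) a"
  by (cases as; cases n) (simp_all add: normal_product_def)

lemma normal_product_snoc_ast_all:
  "as \<noteq> [] \<Longrightarrow> normal_product (Suc (length as)) (as @ [a]) = ast (normal_product (length as) as) a"
  by (cases as) (simp_all add: normal_product_def)

lemma normal_product_closed:
  assumes "as \<in> lists S" "0 < n" "n \<le> length as"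
  shows "normal_product n as \<in> S"
  using assms
proof (induction as arbitrary: n rule: rev_induct)
  case (snoc a as)
  show ?case
  proof (cases "n \<le> length as")
    case True
    with snoc show ?thesis by (simp add: normal_product_snoc_circ circ_closed)
  next
    case False
    with snoc.prems have n: "n = Suc (length as)" by simp
    with snoc show ?thesis
      by (cases "as = []") (simp_all add: normal_product_snoc_ast_all ast_closed)
  qed
qed simp

lemma circ_ast_exchange:
  assumes "a \<in> S" "b \<in> S" "c \<in> S"
  shows "ast (circ a b) c = circ (ast a b) c"
  using mixed1 mixed2 assms by simp

text \<open>A further factor joined by \<open>*\<close> moves its sign to the left past all signs \<open>\<odot>\<close>.\<close>

lemma normal_product_snoc_ast:
  assumes "as \<in> lists S" "a \<in> S" "0 < n" "n \<le> length as"
  shows "normal_product (Suc n) (as @ [a]) = ast (normal_product n as) a"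
  using assms
proof (induction as arbitrary: a rule: rev_induct)
  case (snoc b as)
  show ?case
  proof (cases "n \<le> length as")
    case True
    have "ast (normal_product n (as @ [b])) a = circ (ast (normal_product n as) b) a"
      using snoc.prems True normal_product_closed
      by (simp add: normal_product_snoc_circ circ_ast_exchange)
    also have "\<dots> = circ (normal_product (Suc n) (as @ [b])) a"
      using snoc True by simp
    also have "\<dots> = normal_product (Suc n) ((as @ [b]) @ [a])"
      using True by (subst normal_product_snoc_circ) simp_all
    finally show ?thesis by simp
  next
    case False
    with snoc.prems have "n = length (as @ [b])" by simp
    then show ?thesis using normal_product_snoc_ast_all[of "as @ [b]" a] by simp
  qed
qed simp

text \<open>Both products of normal forms are computed by splitting off the last entry of the second
  one. If \<open>m < length bs\<close>, this entry is joined by \<open>\<odot>\<close>; otherwise all signs in the second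
  normal form are \<open>*\<close>. In either case an axiom rebrackets so that the last entry is multiplied
  onto a product known by induction.\<close>

lemma ast_normal_product:
  assumes as: "as \<in> lists S" "0 < n" "n \<le> length as"
    and bs: "bs \<in> lists S" "0 < m" "m \<le> length bs"
  shows "ast (normal_product n as) (normal_product m bs) = normal_product (n + m) (as @ bs)"
  using bs
proof (induction bs arbitrary: m rule: rev_induct)
  case (snoc b bs)
  note A = normal_product_closed[OF as]
  show ?case
  proof (cases "m \<le> length bs")
    case True
    have "ast (normal_product n as) (normal_product m (bs @ [b]))
        = circ (ast (normal_product n as) (normal_product m bs)) b"
      using True snoc.prems A by (simp add: normal_product_snoc_circ normal_product_closed mixed1)
    also have "\<dots> = circ (normal_product (n + m) (as @ bs)) b"
      using snoc True by simp
    also have "\<dots> = normal_product (n + m) ((as @ bs) @ [b])"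
      using True as by (subst normal_product_snoc_circ) simp_all
    finally show ?thesis by simp
  next
    case False
    with snoc.prems have m: "m = Suc (length bs)" by simp
    show ?thesis
    proof (cases "bs = []")
      case True
      with m snoc.prems show ?thesis using normal_product_snoc_ast[OF as(1) _ as(2,3)] by simp
    next
      case False
      have "ast (normal_product n as) (normal_product m (bs @ [b]))
          = ast (ast (normal_product n as) (normal_product (length bs) bs)) b"
        using False m snoc.prems A
        by (simp add: normal_product_snoc_ast_all normal_product_closed ast_assoc)
      also have "\<dots> = ast (normal_product (n + length bs) (as @ bs)) b"
        using snoc False by simp
      also have "\<dots> = normal_product (Suc (n + length bs)) ((as @ bs) @ [b])"
        using as snoc.prems by (subst normal_product_snoc_ast) simp_all
      finally show ?thesis using m by simp
    qed
  qed
qed simp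

lemma circ_normal_product:
  assumes as: "as \<in> lists S" "0 < n" "n \<le> length as"
    and bs: "bs \<in> lists S" "0 < m" "m \<le> length bs"
  shows "circ (normal_product n as) (normal_product m bs) = normal_product (n + m - 1) (as @ bs)"
  using bs
proof (induction bs arbitrary: m rule: rev_induct)
  case (snoc b bs)
  note A = normal_product_closed[OF as]
  show ?case
  proof (cases "m \<le> length bs")
    case True
    have "circ (normal_product n as) (normal_product m (bs @ [b]))
        = circ (circ (normal_product n as) (normal_product m bs)) b"
      using True snoc.prems A by (simp add: normal_product_snoc_circ normal_product_closed circ_assoc)
    also have "\<dots> = circ (normal_product (n + m - 1) (as @ bs)) b"
      using snoc True by simp
    also have "\<dots> = normal_product (n + m - 1) ((as @ bs) @ [b])"
      using True as snoc.prems by (subst normal_product_snoc_circ) simp_all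
    finally show ?thesis by simp
  next
    case False
    with snoc.prems have m: "m = Suc (length bs)" by simp
    show ?thesis
    proof (cases "bs = []")
      case True
      with m show ?thesis using normal_product_snoc_circ[OF as(3,2)] by simp
    next
      case False
      have "circ (normal_product n as) (normal_product m (bs @ [b]))
          = ast (circ (normal_product n as) (normal_product (length bs) bs)) b"
        using False m snoc.prems A
        by (simp add: normal_product_snoc_ast_all normal_product_closed mixed3)
      also have "\<dots> = ast (normal_product (n + length bs - 1) (as @ bs)) b"
        using snoc False by simp
      also have "\<dots> = normal_product (Suc (n + length bs - 1)) ((as @ bs) @ [b])"
        using as snoc.prems length_greater_0_conv[of bs] False
        by (subst normal_product_snoc_ast) (simp_all del: length_greater_0_conv)
      finally show ?thesis using m as by simp
    qed
  qed
qed simp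

section \<open>Freeness of the disemigroup of pairs of words\<close>

definition evaluate :: "('x \<Rightarrow> 'a) \<Rightarrow> 'x list \<times> 'x list \<Rightarrow> 'a" where
  "evaluate f p = normal_product (length (fst p)) (map f (fst p @ snd p))"

lemma evaluate_word_embed: "evaluate f (word_embed x) = f x"
  by (simp add: evaluate_def word_embed_def)

lemma evaluate_hom:
  assumes f: "f \<in> X \<rightarrow> S"
  shows "evaluate f \<in> disemigroup_hom (free_semigroup X \<times> free_monoid X) ast_bar circ_bar S ast circ"
proof -
  have word: "map f (fst p @ snd p) \<in> lists S" "0 < length (fst p)"
    "length (fst p) \<le> length (map f (fst p @ snd p))"
    if "p \<in> free_semigroup X \<times> free_monoid X" for p
    using that f unfolding word_pairs_iff by (auto simp: Pi_iff)
  show ?thesis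
    unfolding disemigroup_hom_def mem_Collect_eq
  proof (intro conjI ballI funcsetI)
    fix p assume "p \<in> free_semigroup X \<times> free_monoid X"
    then show "evaluate f p \<in> S"
      unfolding evaluate_def by (intro normal_product_closed word)
  next
    fix p q assume "p \<in> free_semigroup X \<times> free_monoid X" "q \<in> free_semigroup X \<times> free_monoid X"
    note pq = word[OF this(1)] word[OF this(2)]
    show "evaluate f (ast_bar p q) = ast (evaluate f p) (evaluate f q)"
      unfolding evaluate_def word_ast_bar cut_ast_bar
      by (subst ast_normal_product[OF pq]) (simp only: map_append)
    show "evaluate f (circ_bar p q) = circ (evaluate f p) (evaluate f q)"
      unfolding evaluate_def word_circ_bar cut_circ_bar
      by (subst circ_normal_product[OF pq]) (simp only: map_append)
  qed
qed

end

lemma (in totally_compatible_disemigroup) disemigroup_hom_restrict: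
  "h \<in> disemigroup_hom S ast circ T ast' circ' \<Longrightarrow>
    restrict h S \<in> disemigroup_hom S ast circ T ast' circ'"
  unfolding disemigroup_hom_def by (simp add: Pi_iff ast_closed circ_closed)

lemma word_pairs_free:
  assumes S: "totally_compatible_disemigroup S ast circ" and f: "f \<in> X \<rightarrow> S"
  shows "\<exists>!h. h \<in> extensional (free_semigroup X \<times> free_monoid X) \<and>
    h \<in> disemigroup_hom (free_semigroup X \<times> free_monoid X) ast_bar circ_bar S ast circ \<and>
    (\<forall>x\<in>X. f x = h (word_embed x))"
proof -
  let ?P = "free_semigroup X \<times> free_monoid X"
  interpret S: totally_compatible_disemigroup S ast circ by (rule S)
  interpret P: totally_compatible_disemigroup ?P ast_bar circ_bar by (rule word_pairs_disemigroup)
  let ?h = "restrict (S.evaluate f) ?P"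
  show ?thesis
  proof (rule ex1I[of _ ?h], intro conjI ballI)
    show hom: "?h \<in> disemigroup_hom ?P ast_bar circ_bar S ast circ"
      by (rule P.disemigroup_hom_restrict[OF S.evaluate_hom[OF f]])
    show letters: "f x = ?h (word_embed x)" if "x \<in> X" for x
      using word_embed_in_word_pairs[OF that] by (simp add: S.evaluate_word_embed)
    fix g assume g: "g \<in> extensional ?P \<and>
      g \<in> disemigroup_hom ?P ast_bar circ_bar S ast circ \<and> (\<forall>x\<in>X. f x = g (word_embed x))"
    show "g = ?h"
    proof (rule extensionalityI[of _ ?P])
      fix p assume p: "p \<in> ?P"
      show "g p = ?h p"
      proof (rule disemigroup_hom_eq_on_letters[OF _ hom _ p])
        show "g (word_embed x) = ?h (word_embed x)" if "x \<in> X" for x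
          using g that letters[OF that] by metis
      qed (use g in blast)
    qed (use g in blast, simp)
  qed simp
qed

section \<open>The free module on a disemigroup\<close>

lemma bilinear_comp_linear:
  assumes "bilinear_map K A B C t" "g \<in> linear_maps K A' A" "h \<in> linear_maps K B' B"
  shows "bilinear_map K A' B' C (\<lambda>a b. t (g a) (h b))"
  using assms unfolding bilinear_map_def linear_maps_def by (simp add: Pi_iff)

lemma linear_maps_id: "(\<lambda>x. x) \<in> linear_maps K M M"
  by (simp add: linear_maps_def)

context cring
begin

text \<open>Each identity of a totally compatible disemigroup has the shape
  \<open>(a \<cdot> b) \<cdot> c = a \<cdot> (b \<cdot> c)\<close> with four operations. Both sides are trilinear after extension, so
  the identity passes from the basis to the free module.\<close>

lemma bilinear_ext_associativity:
  assumes closed: "\<And>a b. \<lbrakk>a \<in> B; b \<in> B\<rbrakk> \<Longrightarrow> op1 a b \<in> B" "\<And>a b. \<lbrakk>a \<in> B; b \<in> B\<rbrakk> \<Longrightarrow> op2 a b \<in> B"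
      "\<And>a b. \<lbrakk>a \<in> B; b \<in> B\<rbrakk> \<Longrightarrow> op3 a b \<in> B" "\<And>a b. \<lbrakk>a \<in> B; b \<in> B\<rbrakk> \<Longrightarrow> op4 a b \<in> B"
    and eq: "\<And>a b c. \<lbrakk>a \<in> B; b \<in> B; c \<in> B\<rbrakk> \<Longrightarrow> op1 (op2 a b) c = op3 a (op4 b c)"
    and pqr: "p \<in> carrier (free_module R B)" "q \<in> carrier (free_module R B)"
      "r \<in> carrier (free_module R B)"
  shows "bilinear_ext R B op1 (bilinear_ext R B op2 p q) r =
    bilinear_ext R B op3 p (bilinear_ext R B op4 q r)"
proof -
  let ?F = "free_module R B"
  have b1: "bilinear_map R ?F ?F ?F (bilinear_ext R B op1)"
    and b2: "bilinear_map R ?F ?F ?F (bilinear_ext R B op2)"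
    and b3: "bilinear_map R ?F ?F ?F (bilinear_ext R B op3)"
    and b4: "bilinear_map R ?F ?F ?F (bilinear_ext R B op4)"
    by (rule bilinear_ext_bilinear, erule (1) closed)+
  have lin: "(\<lambda>x. t x y) \<in> linear_maps R ?F ?F" "t y \<in> linear_maps R ?F ?F"
    if "bilinear_map R ?F ?F ?F t" "y \<in> carrier ?F" for t y
    using that unfolding bilinear_map_def by blast+
  have basis: "bilinear_ext R B op1 (single R (op2 a b)) r =
      bilinear_ext R B op3 (single R a) (bilinear_ext R B op4 (single R b) r)"
    if ab: "a \<in> B" "b \<in> B" for a b
  proof (rule linear_maps_eq_on_basis[OF free_module_is_module _ _ _ pqr(3)])
    note sa = single_closed[OF ab(1)] and sb = single_closed[OF ab(2)]
    show "bilinear_ext R B op1 (single R (op2 a b)) \<in> linear_maps R ?F ?F"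
      by (rule lin(2)[OF b1 single_closed[OF closed(2)[OF ab]]])
    show "(\<lambda>r. bilinear_ext R B op3 (single R a) (bilinear_ext R B op4 (single R b) r))
        \<in> linear_maps R ?F ?F"
      by (rule lin(2)[OF linear_comp_bilinear[OF lin(2)[OF b3 sa] b4] sb])
    show "bilinear_ext R B op1 (single R (op2 a b)) (single R c) =
        bilinear_ext R B op3 (single R a) (bilinear_ext R B op4 (single R b) (single R c))"
      if "c \<in> B" for c
      using ab that by (simp add: bilinear_ext_single closed eq)
  qed
  show ?thesis
  proof (rule bilinear_maps_eq_on_basis[OF free_module_is_module _ _ _ pqr(1,2)])
    show "bilinear_map R ?F ?F ?F (\<lambda>p q. bilinear_ext R B op1 (bilinear_ext R B op2 p q) r)"
      by (rule linear_comp_bilinear[OF lin(1)[OF b1 pqr(3)] b2])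
    show "bilinear_map R ?F ?F ?F (\<lambda>p q. bilinear_ext R B op3 p (bilinear_ext R B op4 q r))"
      by (rule bilinear_comp_linear[OF b3 linear_maps_id lin(1)[OF b4 pqr(3)]])
  qed (simp add: bilinear_ext_single closed basis)
qed

lemma free_module_dialgebra:
  assumes "totally_compatible_disemigroup B s t"
  shows "totally_compatible_dialgebra R (free_module R B) (bilinear_ext R B s) (bilinear_ext R B t)"
proof -
  interpret B: totally_compatible_disemigroup B s t by fact
  let ?F = "free_module R B"
  have s: "bilinear_map R ?F ?F ?F (bilinear_ext R B s)"
    and t: "bilinear_map R ?F ?F ?F (bilinear_ext R B t)"
    by (rule bilinear_ext_bilinear, erule (1) B.ast_closed B.circ_closed)+
  show ?thesis
  proof (intro totally_compatible_dialgebra.intro totally_compatible_disemigroup.intro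
      totally_compatible_dialgebra_axioms.intro free_module_is_module s t
      bilinear_map_closed[OF s] bilinear_map_closed[OF t])
    fix p q r
    assume pqr: "p \<in> carrier ?F" "q \<in> carrier ?F" "r \<in> carrier ?F"
    note ext = bilinear_ext_associativity[OF _ _ _ _ _ pqr]
    note closed = B.ast_closed B.circ_closed
    show "bilinear_ext R B s (bilinear_ext R B s p q) r = bilinear_ext R B s p (bilinear_ext R B s q r)"
      by (rule ext) (simp_all add: closed B.ast_assoc)
    show "bilinear_ext R B t (bilinear_ext R B t p q) r = bilinear_ext R B t p (bilinear_ext R B t q r)"
      by (rule ext) (simp_all add: closed B.circ_assoc)
    show "bilinear_ext R B t (bilinear_ext R B s p q) r = bilinear_ext R B s p (bilinear_ext R B t q r)"
      by (rule ext) (simp_all add: closed B.mixed1)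
    show "bilinear_ext R B s p (bilinear_ext R B t q r) = bilinear_ext R B s (bilinear_ext R B t p q) r"
      by (rule ext[symmetric]) (simp_all add: closed B.mixed2)
    show "bilinear_ext R B s (bilinear_ext R B t p q) r = bilinear_ext R B t p (bilinear_ext R B s q r)"
      by (rule ext) (simp_all add: closed B.mixed3)
  qed
qed

lemma single_disemigroup_hom:
  assumes "totally_compatible_disemigroup B s t"
  shows "single R \<in> disemigroup_hom B s t
    (carrier (free_module R B)) (bilinear_ext R B s) (bilinear_ext R B t)"
proof -
  interpret B: totally_compatible_disemigroup B s t by fact
  show ?thesis
    unfolding disemigroup_hom_def
    by (simp add: single_closed bilinear_ext_single B.ast_closed B.circ_closed Pi_iff
        del: free_module_sel)
qed

lemma linear_ext_dialgebra_hom: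
  assumes B: "totally_compatible_disemigroup B s t"
    and N: "totally_compatible_dialgebra R N ast circ"
    and h: "h \<in> disemigroup_hom B s t (carrier N) ast circ"
  shows "linear_ext R N h \<in>
    dialgebra_hom R (free_module R B) (bilinear_ext R B s) (bilinear_ext R B t) N ast circ"
proof -
  interpret B: totally_compatible_disemigroup B s t by fact
  interpret N: totally_compatible_dialgebra R N ast circ by fact
  let ?F = "free_module R B" and ?g = "linear_ext R N h"
  have hf: "h \<in> B \<rightarrow> carrier N" using h by (simp add: disemigroup_hom_def)
  have lin: "?g \<in> linear_maps R ?F N" by (rule linear_ext_linear[OF N.module_axioms hf])
  have mult: "?g (bilinear_ext R B op p q) = op' (?g p) (?g q)"
    if op: "\<And>a b. \<lbrakk>a \<in> B; b \<in> B\<rbrakk> \<Longrightarrow> op a b \<in> B" and op': "bilinear_map R N N N op'"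
      and hom: "\<And>a b. \<lbrakk>a \<in> B; b \<in> B\<rbrakk> \<Longrightarrow> h (op a b) = op' (h a) (h b)"
      and pq: "p \<in> carrier ?F" "q \<in> carrier ?F" for op op' p q
  proof (rule bilinear_maps_eq_on_basis[OF N.module_axioms _ _ _ pq])
    show "bilinear_map R ?F ?F N (\<lambda>p q. ?g (bilinear_ext R B op p q))"
      by (rule linear_comp_bilinear[OF lin bilinear_ext_bilinear[of B op, OF op]])
    show "bilinear_map R ?F ?F N (\<lambda>p q. op' (?g p) (?g q))"
      by (rule bilinear_comp_linear[OF op' lin lin])
    show "?g (bilinear_ext R B op (single R a) (single R b)) = op' (?g (single R a)) (?g (single R b))"
      if "a \<in> B" "b \<in> B" for a b
      using that by (simp add: bilinear_ext_single op linear_ext_single[OF N.module_axioms hf] hom)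
  qed
  have "?g \<in> carrier ?F \<rightarrow> carrier N" using lin by (simp add: linear_maps_def)
  moreover have "?g (bilinear_ext R B s p q) = ast (?g p) (?g q)"
      "?g (bilinear_ext R B t p q) = circ (?g p) (?g q)"
    if "p \<in> carrier ?F" "q \<in> carrier ?F" for p q
    using h that N.ast_bilinear N.circ_bilinear B.ast_closed B.circ_closed
    by (auto simp: disemigroup_hom_def simp del: free_module_sel intro!: mult)
  ultimately show ?thesis
    unfolding dialgebra_hom_def disemigroup_hom_def using lin by blast
qed

section \<open>Freeness of the dialgebra\<close>

lemma F_embed_eq: "F_embed R x = single R (word_embed x)"
  by (simp add: F_embed_def word_embed_def tensor_single)

lemma inj_single: "\<one> \<noteq> \<zero> \<Longrightarrow> inj (single R)"
  by (rule injI) (metis single_def)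

text \<open>Evaluating pairs of words in the disemigroup underlying \<open>N\<close> gives the values of the
  homomorphism on the basis of \<open>F(X)\<close>. They are forced, since a dialgebra homomorphism restricts to
  a disemigroup homomorphism on the basis, and they determine the homomorphism by linearity.\<close>

lemma F_free:
  assumes N: "totally_compatible_dialgebra R N ast circ" and f: "f \<in> X \<rightarrow> carrier N"
  shows "\<exists>!h. h \<in> extensional (carrier (F_module R X)) \<and>
    h \<in> dialgebra_hom R (F_module R X) (F_ast R X) (F_circ R X) N ast circ \<and>
    (\<forall>x\<in>X. f x = h (F_embed R x))"
proof -
  let ?P = "free_semigroup X \<times> free_monoid X"
  let ?F = "free_module R ?P"
  let ?ast = "bilinear_ext R ?P ast_bar" and ?circ = "bilinear_ext R ?P circ_bar"
  let ?hom = "dialgebra_hom R ?F ?ast ?circ N ast circ"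
  note P = word_pairs_disemigroup[of X]
  interpret N: totally_compatible_dialgebra R N ast circ by (rule N)
  interpret F: totally_compatible_dialgebra R ?F ?ast ?circ by (rule free_module_dialgebra[OF P])
  let ?e = "N.evaluate f"
  let ?h = "restrict (linear_ext R N ?e) (carrier ?F)"
  note e = N.evaluate_hom[OF f]
  have ef: "?e \<in> ?P \<rightarrow> carrier N" using e unfolding disemigroup_hom_def by blast
  have hom: "?h \<in> ?hom"
    using linear_ext_dialgebra_hom[OF P N e] F.ast_closed F.circ_closed F.a_closed F.smult_closed
    unfolding dialgebra_hom_def disemigroup_hom_def linear_maps_def
    by (simp add: Pi_iff del: free_module_sel)
  have letters: "f x = ?h (single R (word_embed x))" if "x \<in> X" for x
    using word_embed_in_word_pairs[OF that]
    by (simp add: single_closed linear_ext_single[OF N.module_axioms ef] N.evaluate_word_embed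
        del: free_module_sel)
  have on_basis: "(\<lambda>p. g (single R p)) \<in> disemigroup_hom ?P ast_bar circ_bar (carrier N) ast circ"
    if "g \<in> ?hom" for g
    using that single_disemigroup_hom[OF P]
    unfolding dialgebra_hom_def disemigroup_hom_def by (simp add: Pi_iff del: free_module_sel)
  show ?thesis
    unfolding F_module_def F_ast_def F_circ_def F_embed_eq
  proof (rule ex1I[of _ ?h], intro conjI ballI)
    fix g assume g: "g \<in> extensional (carrier ?F) \<and> g \<in> ?hom \<and>
      (\<forall>x\<in>X. f x = g (single R (word_embed x)))"
    then have ghom: "g \<in> ?hom" by blast
    have lin: "g \<in> linear_maps R ?F N" "?h \<in> linear_maps R ?F N"
      using ghom hom unfolding dialgebra_hom_def by blast+
    have basis: "g (single R p) = ?h (single R p)" if "p \<in> ?P" for p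
    proof (rule disemigroup_hom_eq_on_letters[OF on_basis[OF ghom] on_basis[OF hom] _ that])
      show "g (single R (word_embed x)) = ?h (single R (word_embed x))" if "x \<in> X" for x
        using g that letters[OF that] by metis
    qed
    show "g = ?h"
    proof (rule extensionalityI[of _ "carrier ?F"])
      show "g p = ?h p" if "p \<in> carrier ?F" for p
        by (rule linear_maps_eq_on_basis[OF N.module_axioms lin basis that])
    qed (use g in blast, rule restrict_extensional)
  next
    show "?h \<in> extensional (carrier ?F)" by (rule restrict_extensional)
  qed (fact hom letters)+
qed

end

theorem theorem4p1:
  fixes X :: "'x set" and K :: "('k, 'm) ring_scheme"
  assumes "cring K"
  shows
    "(totally_compatible_disemigroup (free_semigroup X \<times> free_monoid X) ast_bar circ_bar \<and>
      word_embed \<in> X \<rightarrow> free_semigroup X \<times> free_monoid X \<and> inj_on word_embed X \<and>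
      (\<forall>(S :: 's set) ast circ f.
         totally_compatible_disemigroup S ast circ \<longrightarrow> f \<in> X \<rightarrow> S \<longrightarrow>
         (\<exists>!h. h \<in> extensional (free_semigroup X \<times> free_monoid X) \<and>
               h \<in> disemigroup_hom (free_semigroup X \<times> free_monoid X) ast_bar circ_bar S ast circ \<and>
               (\<forall>x\<in>X. f x = h (word_embed x))))) \<and>
     (totally_compatible_dialgebra K (F_module K X) (F_ast K X) (F_circ K X) \<and>
      F_embed K \<in> X \<rightarrow> carrier (F_module K X) \<and> (\<one>\<^bsub>K\<^esub> \<noteq> \<zero>\<^bsub>K\<^esub> \<longrightarrow> inj_on (F_embed K) X) \<and>
      (\<forall>(R :: ('k, 'r, 'q) module_scheme) ast circ f.
         totally_compatible_dialgebra K R ast circ \<longrightarrow> f \<in> X \<rightarrow> carrier R \<longrightarrow>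
         (\<exists>!h. h \<in> extensional (carrier (F_module K X)) \<and>
               h \<in> dialgebra_hom K (F_module K X) (F_ast K X) (F_circ K X) R ast circ \<and>
               (\<forall>x\<in>X. f x = h (F_embed K x)))))"
proof -
  interpret K: cring K by (rule assms)
  have "inj_on word_embed X"
    by (simp add: inj_on_def word_embed_def)
  moreover from this have "inj_on (F_embed K) X" if "\<one>\<^bsub>K\<^esub> \<noteq> \<zero>\<^bsub>K\<^esub>"
    by (simp add: inj_on_def K.F_embed_eq inj_eq[OF K.inj_single[OF that]])
  moreover have "F_embed K \<in> X \<rightarrow> carrier (F_module K X)"
    unfolding F_module_def
    by (rule funcsetI) (simp only: K.F_embed_eq K.single_closed word_embed_in_word_pairs)
  moreover have "totally_compatible_dialgebra K (F_module K X) (F_ast K X) (F_circ K X)"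
    unfolding F_module_def F_ast_def F_circ_def
    by (rule K.free_module_dialgebra[OF word_pairs_disemigroup])
  moreover have "word_embed \<in> X \<rightarrow> free_semigroup X \<times> free_monoid X"
    by (rule funcsetI) (rule word_embed_in_word_pairs)
  ultimately show ?thesis
    by (intro conjI allI impI word_pairs_disemigroup word_pairs_free K.F_free)
qed

end
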